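(* The constrained random arrival rule $CRA$ for multi-issue bankruptcy problems with crossed claims satisfies equal treatment of equals: for every problem $(\mathcal{I},N,E,c,\alpha)\in\mathcal{MBC}$ and every pair of claimants $j,k\in N$ with $\alpha(j)=\alpha(k)$ and $c_j=c_k$, one has $CRA_j(\mathcal{I},N,E,c,\alpha)=CRA_k(\mathcal{I},N,E,c,\alpha)$.
   Context: A multi-issue bankruptcy problem with crossed claims is a 5-tuple $(\mathcal{I},N,E,c,\alpha)$ where: $\mathcal{I}$ is a nonempty finite set of issues; $N$ is a nonempty finite set of claimants, $n=|N|$; $E=(e_i)_{i\in\mathcal{I}}$ with $e_i\ge 0$ is the vector of available amounts (estates) of the issues; $c=(c_j)_{j\in N}$ with $c_j\ge 0$ is the vector of claims; $\alpha$ associates with every $j\in N$ a nonempty set $\alpha(j)\subset\mathcal{I}$ (the issues to which claimant $j$ asks); and $\sum_{j\in N:\, i\in\alpha(j)}c_j>e_i$ for all $i\in\mathcal{I}$. The family of all these problems is denoted $\mathcal{MBC}$. Let $\Sigma(N)$ be the set of all orders of $N$, i.e. bijections $\sigma:N\to\{1,\ldots,n\}$, where $\sigma(j)$ is the position of $j$. For $\sigma\in\Sigma(N)$, the constrained sequential priority rule $CSP^\sigma$ is defined recursively along the order $\sigma$: for each $j\in N$, $$CSP_j^\sigma(\mathcal{I},N,E,c,\alpha)=\min\Big\{c_j,\ \max\Big\{0,\ \min_{i\in\alpha(j)}\Big(e_i-\sum_{k\in N:\, i\in\alpha(k),\ \sigma(k)<\sigma(j)}CSP_k^\sigma(\mathcal{I},N,E,c,\alpha)\Big)\Big\}\Big\}.$$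 The constrained random arrival rule is the average $$CRA_j(\mathcal{I},N,E,c,\alpha)=\frac{1}{n!}\sum_{\sigma\in\Sigma(N)}CSP_j^\sigma(\mathcal{I},N,E,c,\alpha),\quad j\in N.$$ *)

theory Defs
  imports Complex_Main "HOL-Library.FuncSet"
begin

text \<open>
  A problem is a tuple \<open>(I, N, E, c, \<alpha>)\<close> of issues, claimants, estates, claims and the map
  assigning to each claimant the issues it asks for. The functions \<open>E\<close>, \<open>c\<close> and \<open>\<alpha>\<close> are total;
  only their values on \<open>I\<close> (for \<open>E\<close>) and on \<open>N\<close> (for \<open>c\<close> and \<open>\<alpha>\<close>) are constrained or used.
\<close>

type_synonym ('i, 'a) problem =
  "'i set \<times> 'a set \<times> ('i \<Rightarrow> real) \<times> ('a \<Rightarrow> real) \<times> ('a \<Rightarrow> 'i set)"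

definition MBC :: "('i, 'a) problem set" where
  "MBC = {(I, N, E, c, \<alpha>).
     finite I \<and> I \<noteq> {} \<and> finite N \<and> N \<noteq> {} \<and>
     (\<forall>i\<in>I. E i \<ge> 0) \<and> (\<forall>j\<in>N. c j \<ge> 0) \<and>
     (\<forall>j\<in>N. \<alpha> j \<noteq> {} \<and> \<alpha> j \<subseteq> I) \<and>
     (\<forall>i\<in>I. (\<Sum>j | j \<in> N \<and> i \<in> \<alpha> j. c j) > E i)}"

text \<open>
  Orders are extensional (\<open>undefined\<close> outside \<open>N\<close>), so that each bijection from \<open>N\<close> onto
  \<open>{1..card N}\<close> is counted exactly once.
\<close>

definition orders :: "'a set \<Rightarrow> ('a \<Rightarrow> nat) set" where
  "orders N = {\<sigma> \<in> extensional N. bij_betw \<sigma> N {1..card N}}"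

function CSP :: "('a \<Rightarrow> nat) \<Rightarrow> ('i, 'a) problem \<Rightarrow> 'a \<Rightarrow> real" where
  "CSP \<sigma> (I, N, E, c, \<alpha>) j =
     min (c j) (max 0 (MIN i\<in>\<alpha> j.
       E i - (\<Sum>k | k \<in> N \<and> i \<in> \<alpha> k \<and> \<sigma> k < \<sigma> j. CSP \<sigma> (I, N, E, c, \<alpha>) k)))"
  by pat_completeness auto
termination
  by (relation "measure (\<lambda>(\<sigma>, P, j). \<sigma> j)") auto

text \<open>The unguarded recursion equation would make the simplifier loop.\<close>

declare CSP.simps [simp del]

definition CRA :: "('i, 'a) problem \<Rightarrow> 'a \<Rightarrow> real" where
  "CRA = (\<lambda>(I, N, E, c, \<alpha>) j.
     (\<Sum>\<sigma>\<in>orders N. CSP \<sigma> (I, N, E, c, \<alpha>) j) / fact (card N))"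

end

theory Submission
  imports Defs "HOL-Combinatorics.Permutations"
begin

text \<open>
  Equal treatment of equals is a consequence of anonymity. A claimant's name enters the sequential
  priority rule only through its claim, its issues and its position, so renaming the claimants by a
  permutation \<open>\<pi>\<close> of \<open>N\<close>, in the problem and in the order alike, merely renames the awards
  (\<open>CSP_anonymous\<close>). Averaging over all orders removes the dependence on the order, because
  \<open>\<sigma> \<mapsto> \<sigma> \<circ> \<pi>\<close> only rearranges them (\<open>bij_betw_orders_comp\<close>); hence \<open>CRA\<close> commutes with renaming
  the problem alone (\<open>CRA_anonymous\<close>). If \<open>j\<close> and \<open>k\<close> have the same claim and the same issues, then
  exchanging their names leaves the problem unchanged, and so their awards coincide.
\<close>

text \<open>
  The award of a claimant depends only on the awards of the claimants served earlier, which permits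
  induction on the position. In the step, \<open>\<pi>\<close> maps the predecessors of \<open>m\<close> under \<open>\<sigma> \<circ> \<pi>\<close> that ask
  to an issue onto the predecessors of \<open>\<pi> m\<close> under \<open>\<sigma>\<close> that ask to it in the original problem.
\<close>

lemma CSP_anonymous:
  assumes "\<pi> permutes N"
  shows "CSP (\<sigma> \<circ> \<pi>) (I, N, E, c \<circ> \<pi>, \<alpha> \<circ> \<pi>) m = CSP \<sigma> (I, N, E, c, \<alpha>) (\<pi> m)"
proof (induction "\<sigma> (\<pi> m)" arbitrary: m rule: less_induct)
  case less
  have "(\<Sum>k | k \<in> N \<and> i \<in> \<alpha> (\<pi> k) \<and> \<sigma> (\<pi> k) < \<sigma> (\<pi> m).
           CSP (\<sigma> \<circ> \<pi>) (I, N, E, c \<circ> \<pi>, \<alpha> \<circ> \<pi>) k) =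
        (\<Sum>k | k \<in> N \<and> i \<in> \<alpha> k \<and> \<sigma> k < \<sigma> (\<pi> m). CSP \<sigma> (I, N, E, c, \<alpha>) k)" for i
    by (rule sum.reindex_bij_witness[where j = \<pi> and i = "inv \<pi>"])
      (auto simp: permutes_inverses[OF assms] permutes_in_image[OF assms]
        permutes_in_image[OF permutes_inv[OF assms]] less)
  then show ?case
    by (simp add: CSP.simps[of _ _ _ _ _ _ m] CSP.simps[of _ _ _ _ _ _ "\<pi> m"])
qed

lemma orders_comp:
  assumes "\<pi> permutes N" and "\<sigma> \<in> orders N"
  shows "\<sigma> \<circ> \<pi> \<in> orders N"
  using assms bij_betw_trans[OF permutes_imp_bij[OF assms(1)], of \<sigma> "{1..card N}"]
  by (auto simp: orders_def extensional_def permutes_not_in)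

lemma bij_betw_orders_comp:
  assumes "\<pi> permutes N"
  shows "bij_betw (\<lambda>\<sigma>. \<sigma> \<circ> \<pi>) (orders N) (orders N)"
  by (rule bij_betw_byWitness[where f' = "\<lambda>\<sigma>. \<sigma> \<circ> inv \<pi>"])
    (auto simp: o_assoc[symmetric] permutes_inv_o[OF assms] orders_comp assms permutes_inv)

lemma CRA_anonymous:
  assumes "\<pi> permutes N"
  shows "CRA (I, N, E, c \<circ> \<pi>, \<alpha> \<circ> \<pi>) m = CRA (I, N, E, c, \<alpha>) (\<pi> m)"
proof -
  have "(\<Sum>\<sigma>\<in>orders N. CSP \<sigma> (I, N, E, c \<circ> \<pi>, \<alpha> \<circ> \<pi>) m) =
        (\<Sum>\<sigma>\<in>orders N. CSP (\<sigma> \<circ> \<pi>) (I, N, E, c \<circ> \<pi>, \<alpha> \<circ> \<pi>) m)"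
    by (rule sum.reindex_bij_betw[OF bij_betw_orders_comp[OF assms], symmetric])
  then show ?thesis
    by (simp add: CRA_def CSP_anonymous[OF assms])
qed

theorem theorem2:
  fixes I :: "'i set" and N :: "'a set"
    and E :: "'i \<Rightarrow> real" and c :: "'a \<Rightarrow> real" and \<alpha> :: "'a \<Rightarrow> 'i set"
  assumes "(I, N, E, c, \<alpha>) \<in> MBC"
    and "j \<in> N" and "k \<in> N"
    and "\<alpha> j = \<alpha> k" and "c j = c k"
  shows "CRA (I, N, E, c, \<alpha>) j = CRA (I, N, E, c, \<alpha>) k"
proof -
  let ?\<pi> = "transpose j k"
  have "?\<pi> permutes N"
    using assms(2,3) by (rule permutes_swap_id)
  moreover have "c \<circ> ?\<pi> = c" "\<alpha> \<circ> ?\<pi> = \<alpha>"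
    using assms(4,5) by (auto simp: fun_eq_iff transpose_def)
  ultimately show ?thesis
    using CRA_anonymous[of ?\<pi> N I E c \<alpha> j] by simp
qed

end
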